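(* Let $\mathcal Z$ be a commutative associative unital $\mathbb Q$-algebra, $N,n\in\mathbb N$ with $2\le n\le N$, $Z=(z_{j,r})\in\mathcal Z^{N\times n}$, and let $$\widetilde p^{(2)}=\sum_{R\subseteq[n],\,|R|=2}\widetilde p_{[n]\setminus R}\sum_{j=1}^N\prod_{r\in R}(z_{j,r}-\widetilde z_r),\qquad h_{k,n}=\frac{(n+k-2)(n-k+1)}{k(k-1)(k-2)\binom nk}\ \ (k\in[n]\setminus[2]).$$ Then $$\overline p_{[n]}-\frac{N!\,\widetilde p_{[n]}}{(N-n)!}+\frac{(N-2)!}{(N-n)!}\widetilde p^{(2)}=\frac1{2N^2}\sum_{k\in[n]\setminus[2]}h_{k,n}\sum_{\substack{R\subseteq[n]\\|R|=k}}\ \sum_{(r,s,t)\in R^3_{\neq}}\widetilde p_{[n]\setminus R}\sum_{j\in[N]^n_{\neq}}y_{j_r,j_s,r}\,y_{j_r,j_s,s}\,y_{j_r,j_t,t}\,p_{j,R\setminus\{r,s,t\}}$$ $$+\frac1{8N^2}\sum_{k\in[n]\setminus[3]}h_{k,n}\sum_{\substack{R\subseteq[n]\\|R|=k}}\ \sum_{(q,r,s,t)\in R^4_{\neq}}\widetilde p_{[n]\setminus R}\sum_{j\in[N]^n_{\neq}}y_{j_q,j_r,q}\,y_{j_q,j_r,r}\,y_{j_s,j_t,s}\,y_{j_s,j_t,t}\,p_{j,R\setminus\{q,r,s,t\}},$$ where for $n=2$ the right-hand side is defined to be zero.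
   Context: $[m]=\{1,\dots,m\}$. $[N]^n_{\neq}$ is the set of injective maps $j:[n]\to[N]$, written $(j_1,\dots,j_n)$; for a set $R$ and $m\in\mathbb N$, $R^m_{\neq}$ is the set of $m$-tuples of pairwise distinct elements of $R$. $\widetilde z_r=\frac1N\sum_{j=1}^Nz_{j,r}$, $y_{j,k,r}=z_{j,r}-z_{k,r}$. For $R\subseteq[n]$ and $j\in[N]^n_{\neq}$, $p_{j,R}=\prod_{\ell\in R}z_{j_\ell,\ell}$. $\overline p_R=\sum_{j\in[N]^n_{\neq}}p_{j,R}$ (so $\overline p_{[n]}$ is the permanent of $Z$) and $\widetilde p_R=\prod_{\ell\in R}\widetilde z_\ell$. Empty sums are $0$, empty products are $1$. *)

theory Defs
  imports Complex_Main "HOL-Library.FuncSet"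
begin

text \<open>
  Commutative associative unital algebras over the rationals. The sort \<open>{comm_ring, comm_monoid_mult}\<close>
  describes commutative unital rings without the axiom \<open>0 \<noteq> 1\<close> of \<open>comm_ring_1\<close>, so that the
  zero algebra is included.
\<close>

locale rat_algebra = vector_space scale
  for scale :: "rat \<Rightarrow> 'a::{comm_ring, comm_monoid_mult} \<Rightarrow> 'a" +
  assumes scale_mult_left: "scale q (x * y) = scale q x * y"

text \<open>The set \<open>[N]\<^sup>n\<close> of \<open>n\<close>-tuples with pairwise distinct entries, as extensional functions on \<open>{1..n}\<close>.\<close>

definition inj_tuples :: "nat \<Rightarrow> nat \<Rightarrow> (nat \<Rightarrow> nat) set" where
  "inj_tuples N n = {j \<in> {1..n} \<rightarrow>\<^sub>E {1..N}. inj_on j {1..n}}"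

definition distinct_triples :: "'b set \<Rightarrow> ('b \<times> 'b \<times> 'b) set" where
  "distinct_triples R = {(r, s, t). {r, s, t} \<subseteq> R \<and> distinct [r, s, t]}"

definition distinct_quadruples :: "'b set \<Rightarrow> ('b \<times> 'b \<times> 'b \<times> 'b) set" where
  "distinct_quadruples R = {(q, r, s, t). {q, r, s, t} \<subseteq> R \<and> distinct [q, r, s, t]}"

text \<open>
  An \<open>N \<times> n\<close> matrix is a function \<open>z :: nat \<Rightarrow> nat \<Rightarrow> 'a\<close>, of which only the entries \<open>z j r\<close> with
  \<open>j \<in> {1..N}\<close> and \<open>r \<in> {1..n}\<close> are used.
\<close>

definition z_tilde ::
  "(rat \<Rightarrow> 'a::{comm_ring, comm_monoid_mult} \<Rightarrow> 'a) \<Rightarrow> nat \<Rightarrow> (nat \<Rightarrow> nat \<Rightarrow> 'a) \<Rightarrow> nat \<Rightarrow> 'a" where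
  "z_tilde scale N z r = scale (1 / of_nat N) (\<Sum>j\<in>{1..N}. z j r)"

definition y_diff :: "(nat \<Rightarrow> nat \<Rightarrow> 'a::comm_ring) \<Rightarrow> nat \<Rightarrow> nat \<Rightarrow> nat \<Rightarrow> 'a" where
  "y_diff z j k r = z j r - z k r"

definition p_prod ::
  "(nat \<Rightarrow> nat \<Rightarrow> 'a::{comm_ring, comm_monoid_mult}) \<Rightarrow> (nat \<Rightarrow> nat) \<Rightarrow> nat set \<Rightarrow> 'a" where
  "p_prod z j R = (\<Prod>l\<in>R. z (j l) l)"

definition p_bar ::
  "nat \<Rightarrow> nat \<Rightarrow> (nat \<Rightarrow> nat \<Rightarrow> 'a::{comm_ring, comm_monoid_mult}) \<Rightarrow> nat set \<Rightarrow> 'a" where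
  "p_bar N n z R = (\<Sum>j\<in>inj_tuples N n. p_prod z j R)"

definition p_tilde ::
  "(rat \<Rightarrow> 'a::{comm_ring, comm_monoid_mult} \<Rightarrow> 'a) \<Rightarrow> nat \<Rightarrow> (nat \<Rightarrow> nat \<Rightarrow> 'a) \<Rightarrow> nat set \<Rightarrow> 'a" where
  "p_tilde scale N z R = (\<Prod>l\<in>R. z_tilde scale N z l)"

definition p_tilde2 ::
  "(rat \<Rightarrow> 'a::{comm_ring, comm_monoid_mult} \<Rightarrow> 'a) \<Rightarrow> nat \<Rightarrow> nat \<Rightarrow> (nat \<Rightarrow> nat \<Rightarrow> 'a) \<Rightarrow> 'a" where
  "p_tilde2 scale N n z =
     (\<Sum>R | R \<subseteq> {1..n} \<and> card R = 2.
        p_tilde scale N z ({1..n} - R) *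
        (\<Sum>j\<in>{1..N}. \<Prod>r\<in>R. (z j r - z_tilde scale N z r)))"

definition h_coeff :: "nat \<Rightarrow> nat \<Rightarrow> rat" where
  "h_coeff k n =
     (of_nat n + of_nat k - 2) * (of_nat n - of_nat k + 1) /
     (of_nat k * (of_nat k - 1) * (of_nat k - 2) * of_nat (n choose k))"

end

theory Submission
  imports Defs "HOL-Combinatorics.Permutations"
begin

text \<open>
  Sums over \<open>[N]\<^sup>n\<close> with distinct entries are replaced by sums over all permutations \<open>\<sigma>\<close> of \<open>[N]\<close>, which
  differ by the factor \<open>(N - n)!\<close>. Then \<open>N z_tilde s = \<Sum>m\<in>[N]. z (\<sigma> m) s\<close> for every \<open>\<sigma>\<close>, and if
  \<open>f \<sigma>\<close> only depends on \<open>\<sigma>\<close> on a set \<open>K\<close>, then by transposing \<open>m\<close> and \<open>s\<close> all \<open>m\<close> outside \<open>K\<close>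
  contribute alike to \<open>N z_tilde s * (\<Sum>\<sigma>. f \<sigma>)\<close>. Applied to \<open>p\<^sub>R\<close> this gives
  \<open>(n - k + 1) F\<^bsub>k-1\<^esub> = k F\<^sub>k + G\<^sub>k / (2 N)\<close>, where \<open>F\<^sub>k\<close> is the sum of all
  \<open>p_tilde ([n] - R) * (\<Sum>\<sigma>. p\<^sub>R)\<close> with \<open>|R| = k\<close> and \<open>G\<^sub>k\<close> has in addition one factor
  \<open>y\<^bsub>r,s,r\<^esub> y\<^bsub>r,s,s\<^esub>\<close>. Applied once more, to \<open>G\<^sub>k\<close>, it gives
  \<open>(n - k + 1) G\<^bsub>k-1\<^esub> = (k - 2) G\<^sub>k + U\<^sub>k\<close> with \<open>U\<^sub>k\<close> the triple and quadruple sums of the theorem.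
  A suitable combination of the two recursions telescopes from \<open>k = 2\<close>, where \<open>G\<^sub>2\<close> is a multiple of
  \<open>p_tilde2\<close>, to \<open>k = n\<close>, where \<open>F\<^sub>n\<close> is a multiple of the permanent.
\<close>

section \<open>Sums over the permutations of [N]\<close>

definition perm_sum :: "nat \<Rightarrow> ((nat \<Rightarrow> nat) \<Rightarrow> 'a::comm_monoid_add) \<Rightarrow> 'a" where
  "perm_sum N f = (\<Sum>\<sigma> | \<sigma> permutes {1..N}. f \<sigma>)"

text \<open>Composing on the right with a transposition permutes the summation range and exchanges
  the values \<open>\<sigma> a\<close> and \<open>\<sigma> b\<close>. The symmetry arguments below
  all rest on this.\<close>

lemma perm_sum_transpose:
  assumes "a \<in> {1..N}" "b \<in> {1..N}"
  shows "perm_sum N (\<lambda>\<sigma>. f (\<sigma> \<circ> transpose a b)) = perm_sum N f"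
  unfolding perm_sum_def
  by (rule sum_permutations_compose_right[symmetric]) (use assms in \<open>blast intro: permutes_swap_id\<close>)

lemma perm_sum_add: "perm_sum N (\<lambda>\<sigma>. f \<sigma> + g \<sigma>) = perm_sum N f + perm_sum N g"
  by (simp add: perm_sum_def sum.distrib)

lemma perm_sum_diff:
  fixes f :: "(nat \<Rightarrow> nat) \<Rightarrow> 'a::ab_group_add"
  shows "perm_sum N (\<lambda>\<sigma>. f \<sigma> - g \<sigma>) = perm_sum N f - perm_sum N g"
  by (simp add: perm_sum_def sum_subtractf)

lemma perm_sum_sum: "perm_sum N (\<lambda>\<sigma>. \<Sum>i\<in>A. f i \<sigma>) = (\<Sum>i\<in>A. perm_sum N (f i))"
  unfolding perm_sum_def by (rule sum.swap)

lemma perm_sum_mult_left: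
  fixes c :: "'a::semiring_0"
  shows "c * perm_sum N f = perm_sum N (\<lambda>\<sigma>. c * f \<sigma>)"
  by (simp add: perm_sum_def sum_distrib_left)

lemma perm_sum_cong:
  "(\<And>\<sigma>. \<sigma> permutes {1..N} \<Longrightarrow> f \<sigma> = g \<sigma>) \<Longrightarrow> perm_sum N f = perm_sum N g"
  by (auto simp: perm_sum_def intro: sum.cong)

section \<open>Sums over tuples of distinct indices\<close>

lemma sum_swap_remove:
  assumes "finite R"
  shows "(\<Sum>r\<in>R. \<Sum>s\<in>R - {r}. f r s) = (\<Sum>s\<in>R. \<Sum>r\<in>R - {s}. f r s)"
proof -
  have "R - {r} = {s \<in> R. s \<noteq> r}" for r by blast
  then show ?thesis
    using sum.swap_restrict[OF assms assms, of f "\<lambda>r s. s \<noteq> r"] by (simp add: neq_commute)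
qed

lemma sum_distinct_triples:
  assumes "finite R"
  shows "(\<Sum>(r, s, t)\<in>distinct_triples R. f r s t) = (\<Sum>r\<in>R. \<Sum>s\<in>R - {r}. \<Sum>t\<in>R - {r, s}. f r s t)"
proof -
  have "distinct_triples R = Sigma R (\<lambda>r. Sigma (R - {r}) (\<lambda>s. R - {r, s}))"
    by (auto simp: distinct_triples_def)
  then show ?thesis using assms by (simp add: sum.Sigma)
qed

lemma sum_distinct_quadruples:
  assumes "finite R"
  shows "(\<Sum>(q, r, s, t)\<in>distinct_quadruples R. f q r s t) =
    (\<Sum>q\<in>R. \<Sum>r\<in>R - {q}. \<Sum>s\<in>R - {q, r}. \<Sum>t\<in>R - {q, r, s}. f q r s t)"
proof -
  have "distinct_quadruples R =
      Sigma R (\<lambda>q. Sigma (R - {q}) (\<lambda>r. Sigma (R - {q, r}) (\<lambda>s. R - {q, r, s})))"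
    by (auto simp: distinct_quadruples_def)
  then show ?thesis using assms by (simp add: sum.Sigma)
qed

section \<open>Monomials and their pair, triple and quadruple variants\<close>

lemma p_prod_transpose:
  assumes "a \<notin> R" "b \<notin> R"
  shows "p_prod z (\<sigma> \<circ> transpose a b) R = p_prod z \<sigma> R"
  unfolding p_prod_def
proof (rule prod.cong[OF refl])
  fix l assume "l \<in> R"
  then have "l \<noteq> a" "l \<noteq> b" using assms by auto
  then show "z ((\<sigma> \<circ> transpose a b) l) l = z (\<sigma> l) l" by (simp add: transpose_def)
qed

lemma p_prod_remove:
  assumes "finite R" "q \<in> R"
  shows "p_prod z \<sigma> R = z (\<sigma> q) q * p_prod z \<sigma> (R - {q})"
  unfolding p_prod_def by (rule prod.remove[OF assms])

definition pair_sum :: "nat \<Rightarrow> (nat \<Rightarrow> nat \<Rightarrow> 'a::{comm_ring, comm_monoid_mult}) \<Rightarrow> nat set \<Rightarrow> nat \<Rightarrow> nat \<Rightarrow> 'a" where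
  "pair_sum N z R r s =
     perm_sum N (\<lambda>\<sigma>. y_diff z (\<sigma> r) (\<sigma> s) r * y_diff z (\<sigma> r) (\<sigma> s) s * p_prod z \<sigma> (R - {r, s}))"

definition triple_sum ::
  "nat \<Rightarrow> (nat \<Rightarrow> nat \<Rightarrow> 'a::{comm_ring, comm_monoid_mult}) \<Rightarrow> nat set \<Rightarrow> nat \<Rightarrow> nat \<Rightarrow> nat \<Rightarrow> 'a" where
  "triple_sum N z R r s t =
     perm_sum N (\<lambda>\<sigma>. y_diff z (\<sigma> r) (\<sigma> s) r * y_diff z (\<sigma> r) (\<sigma> s) s * y_diff z (\<sigma> r) (\<sigma> t) t *
       p_prod z \<sigma> (R - {r, s, t}))"

definition quad_sum ::
  "nat \<Rightarrow> (nat \<Rightarrow> nat \<Rightarrow> 'a::{comm_ring, comm_monoid_mult}) \<Rightarrow> nat set \<Rightarrow> nat \<Rightarrow> nat \<Rightarrow> nat \<Rightarrow> nat \<Rightarrow> 'a" where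
  "quad_sum N z R q r s t =
     perm_sum N (\<lambda>\<sigma>. y_diff z (\<sigma> q) (\<sigma> r) q * y_diff z (\<sigma> q) (\<sigma> r) r *
       y_diff z (\<sigma> s) (\<sigma> t) s * y_diff z (\<sigma> s) (\<sigma> t) t * p_prod z \<sigma> (R - {q, r, s, t}))"

definition pair_total :: "nat \<Rightarrow> (nat \<Rightarrow> nat \<Rightarrow> 'a::{comm_ring, comm_monoid_mult}) \<Rightarrow> nat set \<Rightarrow> 'a" where
  "pair_total N z R = (\<Sum>r\<in>R. \<Sum>s\<in>R - {r}. pair_sum N z R r s)"

definition triple_total :: "nat \<Rightarrow> (nat \<Rightarrow> nat \<Rightarrow> 'a::{comm_ring, comm_monoid_mult}) \<Rightarrow> nat set \<Rightarrow> 'a" where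
  "triple_total N z R = (\<Sum>(r, s, t)\<in>distinct_triples R. triple_sum N z R r s t)"

definition quad_total :: "nat \<Rightarrow> (nat \<Rightarrow> nat \<Rightarrow> 'a::{comm_ring, comm_monoid_mult}) \<Rightarrow> nat set \<Rightarrow> 'a" where
  "quad_total N z R = (\<Sum>(q, r, s, t)\<in>distinct_quadruples R. quad_sum N z R q r s t)"

text \<open>The weight \<open>F\<close> is left open so that linearity and the passage from level
  \<open>k\<close> to level \<open>k - 1\<close> are proved once for all the sums in the
  outline.\<close>

definition level_sum ::
  "(rat \<Rightarrow> 'a::{comm_ring, comm_monoid_mult} \<Rightarrow> 'a) \<Rightarrow> nat \<Rightarrow> nat \<Rightarrow> (nat \<Rightarrow> nat \<Rightarrow> 'a) \<Rightarrow> nat \<Rightarrow> (nat set \<Rightarrow> 'a) \<Rightarrow> 'a"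
  where
  "level_sum scale N n z k F =
     (\<Sum>R | R \<subseteq> {1..n} \<and> card R = k. p_tilde scale N z ({1..n} - R) * F R)"

section \<open>Multiplication by a column mean\<close>

context rat_algebra
begin

lemma scale_mult_right: "scale q (x * y) = x * scale q y"
  by (metis mult.commute scale_mult_left)

lemma scale_two: "scale 2 x = x + x"
  using scale_left_distrib[of 1 1 x] by simp

lemma scale_z_tilde: "0 < N \<Longrightarrow> scale (of_nat N) (z_tilde scale N z s) = (\<Sum>j\<in>{1..N}. z j s)"
  by (simp add: z_tilde_def)

lemma sum_perm: "\<sigma> permutes A \<Longrightarrow> (\<Sum>m\<in>A. g (\<sigma> m)) = (\<Sum>m\<in>A. g m)"
  using sum.permute[of \<sigma> A g] by (simp add: comp_def)

lemma perm_sum_const: "perm_sum N (\<lambda>_. c) = scale (fact N) c"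
  using card_permutations[of "{1..N}" N] by (simp add: perm_sum_def sum_constant_scale)

text \<open>Each entry \<open>z (\<sigma> m) s\<close> of the column sum is
  \<open>z (\<sigma> s) s\<close> plus a difference. Transposing \<open>s\<close> and
  \<open>m\<close> shows that the difference contributes zero for \<open>m\<close> outside
  \<open>K\<close>, so only the corrections from \<open>K\<close> survive. The assumption
  \<open>inv\<close> expresses that \<open>f\<close> ignores the values outside
  \<open>K\<close>.\<close>

lemma z_tilde_mult_perm_sum:
  assumes K: "K \<subseteq> {1..N}" and s: "s \<in> {1..N} - K"
    and inv: "\<And>m \<sigma>. m \<in> {1..N} - K \<Longrightarrow> f (\<sigma> \<circ> transpose s m) = f \<sigma>"
  shows "scale (of_nat N) (z_tilde scale N z s * perm_sum N f) =
     scale (of_nat N) (perm_sum N (\<lambda>\<sigma>. z (\<sigma> s) s * f \<sigma>)) +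
     (\<Sum>q\<in>K. perm_sum N (\<lambda>\<sigma>. y_diff z (\<sigma> q) (\<sigma> s) s * f \<sigma>))"
proof -
  have "0 < N" using s by auto
  then have "scale (of_nat N) (z_tilde scale N z s * perm_sum N f) = (\<Sum>j\<in>{1..N}. z j s) * perm_sum N f"
    by (simp add: scale_mult_left scale_z_tilde)
  \<comment> \<open>The column sum is reindexed by each \<open>\<sigma>\<close> separately, which is
    possible only after it has been moved inside the sum over permutations.\<close>
  also have "\<dots> = perm_sum N (\<lambda>\<sigma>. \<Sum>m\<in>{1..N}. z (\<sigma> m) s * f \<sigma>)"
    by (auto simp: perm_sum_mult_left sum_perm[of _ _ "\<lambda>j. z j s"] sum_distrib_right[symmetric] intro!: perm_sum_cong)
  also have "\<dots> = (\<Sum>m\<in>{1..N}. perm_sum N (\<lambda>\<sigma>. z (\<sigma> s) s * f \<sigma>) +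
      perm_sum N (\<lambda>\<sigma>. y_diff z (\<sigma> m) (\<sigma> s) s * f \<sigma>))"
    by (simp add: perm_sum_sum perm_sum_add[symmetric] y_diff_def algebra_simps)
  also have "\<dots> = scale (of_nat N) (perm_sum N (\<lambda>\<sigma>. z (\<sigma> s) s * f \<sigma>)) +
      (\<Sum>m\<in>{1..N}. perm_sum N (\<lambda>\<sigma>. y_diff z (\<sigma> m) (\<sigma> s) s * f \<sigma>))"
    by (simp add: sum.distrib sum_constant_scale)
  also have "(\<Sum>m\<in>{1..N}. perm_sum N (\<lambda>\<sigma>. y_diff z (\<sigma> m) (\<sigma> s) s * f \<sigma>)) =
      (\<Sum>m\<in>K. perm_sum N (\<lambda>\<sigma>. y_diff z (\<sigma> m) (\<sigma> s) s * f \<sigma>))"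
  proof (rule sum.mono_neutral_right)
    show "\<forall>m\<in>{1..N} - K. perm_sum N (\<lambda>\<sigma>. y_diff z (\<sigma> m) (\<sigma> s) s * f \<sigma>) = 0"
    proof
      fix m assume m: "m \<in> {1..N} - K"
      have "perm_sum N (\<lambda>\<sigma>. z (\<sigma> m) s * f \<sigma>) = perm_sum N (\<lambda>\<sigma>. z (\<sigma> s) s * f \<sigma>)"
        using perm_sum_transpose[of s N m "\<lambda>\<sigma>. z (\<sigma> s) s * f \<sigma>"] m s inv[OF m] by simp
      then show "perm_sum N (\<lambda>\<sigma>. y_diff z (\<sigma> m) (\<sigma> s) s * f \<sigma>) = 0"
        by (simp add: y_diff_def left_diff_distrib perm_sum_diff)
    qed
  qed (use K in auto)
  finally show ?thesis .
qed

text \<open>Transposing \<open>a\<close> and \<open>b\<close> leaves the sum unchanged but flips the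
  sign of the difference and turns \<open>z (\<sigma> a) a\<close> into
  \<open>z (\<sigma> b) a\<close>. Averaging the two forms produces the second difference and the
  factor 1/2.\<close>

lemma perm_sum_symmetrize:
  assumes "a \<in> {1..N}" "b \<in> {1..N}"
    and inv: "\<And>\<sigma>. g (\<sigma> \<circ> transpose a b) = g \<sigma>"
  shows "perm_sum N (\<lambda>\<sigma>. y_diff z (\<sigma> a) (\<sigma> b) b * (z (\<sigma> a) a * g \<sigma>)) =
    scale (1/2) (perm_sum N (\<lambda>\<sigma>. y_diff z (\<sigma> a) (\<sigma> b) a * y_diff z (\<sigma> a) (\<sigma> b) b * g \<sigma>))"
proof -
  define P where "P = perm_sum N (\<lambda>\<sigma>. y_diff z (\<sigma> a) (\<sigma> b) b * (z (\<sigma> a) a * g \<sigma>))"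
  define P' where "P' = perm_sum N (\<lambda>\<sigma>. y_diff z (\<sigma> b) (\<sigma> a) b * (z (\<sigma> b) a * g \<sigma>))"
  have "P = P'"
    using perm_sum_transpose[OF assms(1,2), of "\<lambda>\<sigma>. y_diff z (\<sigma> a) (\<sigma> b) b * (z (\<sigma> a) a * g \<sigma>)"]
    by (simp add: P_def P'_def inv)
  then have "P + P = P + P'" by simp
  also have "\<dots> = perm_sum N (\<lambda>\<sigma>. y_diff z (\<sigma> a) (\<sigma> b) a * y_diff z (\<sigma> a) (\<sigma> b) b * g \<sigma>)"
    unfolding P_def P'_def perm_sum_add[symmetric]
    by (rule perm_sum_cong) (simp add: y_diff_def algebra_simps)
  finally have "P + P = perm_sum N (\<lambda>\<sigma>. y_diff z (\<sigma> a) (\<sigma> b) a * y_diff z (\<sigma> a) (\<sigma> b) b * g \<sigma>)" .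
  then show ?thesis
    unfolding P_def[symmetric] by (metis scale_two scale_scale nonzero_eq_divide_eq scale_one zero_neq_numeral)
qed

text \<open>Here \<open>K\<close> is \<open>R - {s}\<close>. For each \<open>q\<close> in it the
  monomial contains \<open>z (\<sigma> q) q\<close>, so the correction symmetrizes to half a pair
  sum.\<close>

lemma z_tilde_mult_p_prod:
  assumes R: "R \<subseteq> {1..N}" and s: "s \<in> R"
  shows "scale (of_nat N) (z_tilde scale N z s * perm_sum N (\<lambda>\<sigma>. p_prod z \<sigma> (R - {s}))) =
    scale (of_nat N) (perm_sum N (\<lambda>\<sigma>. p_prod z \<sigma> R)) +
    scale (1/2) (\<Sum>q\<in>R - {s}. pair_sum N z R q s)"
proof -
  have fin: "finite R" using R finite_subset by blast
  have "scale (of_nat N) (z_tilde scale N z s * perm_sum N (\<lambda>\<sigma>. p_prod z \<sigma> (R - {s}))) =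
     scale (of_nat N) (perm_sum N (\<lambda>\<sigma>. z (\<sigma> s) s * p_prod z \<sigma> (R - {s}))) +
     (\<Sum>q\<in>R - {s}. perm_sum N (\<lambda>\<sigma>. y_diff z (\<sigma> q) (\<sigma> s) s * p_prod z \<sigma> (R - {s})))"
    by (rule z_tilde_mult_perm_sum) (use R s in \<open>auto simp: p_prod_transpose\<close>)
  moreover have "perm_sum N (\<lambda>\<sigma>. y_diff z (\<sigma> q) (\<sigma> s) s * p_prod z \<sigma> (R - {s})) =
      scale (1/2) (pair_sum N z R q s)" if q: "q \<in> R - {s}" for q
  proof -
    have "R - {s} - {q} = R - {q, s}" by blast
    then have "p_prod z \<sigma> (R - {s}) = z (\<sigma> q) q * p_prod z \<sigma> (R - {q, s})" for \<sigma>
      using p_prod_remove[of "R - {s}" q z \<sigma>] fin q by simp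
    then show ?thesis
      using R s q by (auto simp: pair_sum_def p_prod_transpose intro!: perm_sum_symmetrize)
  qed
  ultimately show ?thesis
    by (simp add: p_prod_remove[OF fin s, symmetric] scale_sum_right)
qed

text \<open>Now \<open>K\<close> is \<open>R - {t}\<close>. The corrections from \<open>r\<close>
  and from \<open>s\<close> are the same triple sum, whence the factor 2. Every other
  \<open>q\<close> still has its entry in the monomial, and symmetrizing it with \<open>t\<close>
  gives half a quadruple sum.\<close>

lemma z_tilde_mult_pair_sum:
  assumes R: "R \<subseteq> {1..N}" and rst: "r \<in> R" "s \<in> R" "t \<in> R" "distinct [r, s, t]"
  shows "scale (of_nat N) (z_tilde scale N z t * pair_sum N z (R - {t}) r s) =
    scale (of_nat N) (pair_sum N z R r s) + scale 2 (triple_sum N z R r s t) +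
    scale (1/2) (\<Sum>q\<in>R - {r, s, t}. quad_sum N z R r s q t)"
proof -
  have fin: "finite R" using R finite_subset by blast
  define g where "g \<sigma> = y_diff z (\<sigma> r) (\<sigma> s) r * y_diff z (\<sigma> r) (\<sigma> s) s" for \<sigma> :: "nat \<Rightarrow> nat"
  define f where "f \<sigma> = g \<sigma> * p_prod z \<sigma> (R - {r, s, t})" for \<sigma>
  have g_transpose: "g (\<sigma> \<circ> transpose a b) = g \<sigma>" if "a \<notin> {r, s}" "b \<notin> {r, s}" for \<sigma> a b
    using that by (auto simp: g_def transpose_def)
  have Rt: "R - {t} - {r, s} = R - {r, s, t}" by blast
  have Rrs: "R - {r, s} - {t} = R - {r, s, t}" by blast
  have "scale (of_nat N) (z_tilde scale N z t * perm_sum N f) =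
     scale (of_nat N) (perm_sum N (\<lambda>\<sigma>. z (\<sigma> t) t * f \<sigma>)) +
     (\<Sum>q\<in>R - {t}. perm_sum N (\<lambda>\<sigma>. y_diff z (\<sigma> q) (\<sigma> t) t * f \<sigma>))"
  proof (rule z_tilde_mult_perm_sum)
    fix m \<sigma> assume "m \<in> {1..N} - (R - {t})"
    then have "t \<notin> {r, s}" "m \<notin> {r, s}" "t \<notin> R - {r, s, t}" "m \<notin> R - {r, s, t}" using rst by auto
    then show "f (\<sigma> \<circ> transpose t m) = f \<sigma>"
      unfolding f_def by (intro arg_cong2[of _ _ _ _ "(*)"] g_transpose p_prod_transpose)
  qed (use R rst in auto)
  moreover have "perm_sum N f = pair_sum N z (R - {t}) r s"
    by (simp add: f_def[abs_def] g_def pair_sum_def Rt)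
  moreover have "perm_sum N (\<lambda>\<sigma>. z (\<sigma> t) t * f \<sigma>) = pair_sum N z R r s"
    unfolding pair_sum_def
  proof (rule perm_sum_cong)
    fix \<sigma>
    show "z (\<sigma> t) t * f \<sigma> =
        y_diff z (\<sigma> r) (\<sigma> s) r * y_diff z (\<sigma> r) (\<sigma> s) s * p_prod z \<sigma> (R - {r, s})"
      using p_prod_remove[of "R - {r, s}" t z \<sigma>] fin rst unfolding Rrs by (simp add: f_def g_def mult_ac)
  qed
  moreover have "(\<Sum>q\<in>R - {t}. perm_sum N (\<lambda>\<sigma>. y_diff z (\<sigma> q) (\<sigma> t) t * f \<sigma>)) =
      perm_sum N (\<lambda>\<sigma>. y_diff z (\<sigma> r) (\<sigma> t) t * f \<sigma>) + perm_sum N (\<lambda>\<sigma>. y_diff z (\<sigma> s) (\<sigma> t) t * f \<sigma>) +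
      (\<Sum>q\<in>R - {r, s, t}. perm_sum N (\<lambda>\<sigma>. y_diff z (\<sigma> q) (\<sigma> t) t * f \<sigma>))"
  proof -
    have "sum h (R - {t}) = h r + h s + sum h (R - {r, s, t})" for h :: "nat \<Rightarrow> 'a"
    proof -
      have "sum h (R - {t}) = h r + sum h (R - {t} - {r})"
        by (rule sum.remove) (use fin rst in auto)
      also have "sum h (R - {t} - {r}) = h s + sum h (R - {t} - {r} - {s})"
        by (rule sum.remove) (use fin rst in auto)
      also have "R - {t} - {r} - {s} = R - {r, s, t}" by blast
      finally show ?thesis by (simp only: add.assoc)
    qed
    then show ?thesis .
  qed
  moreover have r: "perm_sum N (\<lambda>\<sigma>. y_diff z (\<sigma> r) (\<sigma> t) t * f \<sigma>) = triple_sum N z R r s t"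
    by (simp add: triple_sum_def f_def g_def mult_ac)
  moreover have "perm_sum N (\<lambda>\<sigma>. y_diff z (\<sigma> s) (\<sigma> t) t * f \<sigma>) = triple_sum N z R r s t"
  proof -
    \<comment> \<open>Both differences of the pair factor change sign, so their product does
      not.\<close>
    have "f (\<sigma> \<circ> transpose r s) = f \<sigma>" for \<sigma>
      by (simp add: f_def g_def p_prod_transpose) (simp add: y_diff_def algebra_simps)
    then show ?thesis
      using perm_sum_transpose[of r N s "\<lambda>\<sigma>. y_diff z (\<sigma> s) (\<sigma> t) t * f \<sigma>"] R rst r
      by (simp add: subset_iff)
  qed
  moreover have "perm_sum N (\<lambda>\<sigma>. y_diff z (\<sigma> q) (\<sigma> t) t * f \<sigma>) = scale (1/2) (quad_sum N z R r s q t)"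
    if q: "q \<in> R - {r, s, t}" for q
  proof -
    define g' where "g' \<sigma> = g \<sigma> * p_prod z \<sigma> (R - {r, s, q, t})" for \<sigma>
    have "R - {r, s, t} - {q} = R - {r, s, q, t}" by blast
    then have "f \<sigma> = z (\<sigma> q) q * g' \<sigma>" for \<sigma>
      using p_prod_remove[of "R - {r, s, t}" q z \<sigma>] fin q by (simp add: f_def g'_def mult_ac)
    moreover have "perm_sum N (\<lambda>\<sigma>. y_diff z (\<sigma> q) (\<sigma> t) t * (z (\<sigma> q) q * g' \<sigma>)) =
      scale (1/2) (perm_sum N (\<lambda>\<sigma>. y_diff z (\<sigma> q) (\<sigma> t) q * y_diff z (\<sigma> q) (\<sigma> t) t * g' \<sigma>))"
      by (rule perm_sum_symmetrize) (use R rst q in \<open>auto simp: g'_def g_transpose p_prod_transpose\<close>)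
    ultimately show ?thesis by (simp add: quad_sum_def g'_def g_def mult_ac)
  qed
  ultimately show ?thesis
    by (simp add: scale_sum_right scale_two add.assoc)
qed

section \<open>Totals over a fixed index set\<close>

lemma sum_z_tilde_mult_p_prod:
  assumes R: "R \<subseteq> {1..N}"
  shows "scale (of_nat N) (\<Sum>s\<in>R. z_tilde scale N z s * perm_sum N (\<lambda>\<sigma>. p_prod z \<sigma> (R - {s}))) =
    scale (of_nat N * of_nat (card R)) (perm_sum N (\<lambda>\<sigma>. p_prod z \<sigma> R)) +
    scale (1/2) (pair_total N z R)"
proof -
  have "finite R" using R finite_subset by blast
  then show ?thesis
    by (simp add: scale_sum_right z_tilde_mult_p_prod[OF R] sum.distrib sum_constant_scale mult.commute
        pair_total_def sum_swap_remove[of R "\<lambda>r s. scale _ (pair_sum N z R r s)"])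
qed

text \<open>The sum over \<open>t\<close> of the pair totals of \<open>R - {t}\<close> is rearranged
  into a sum over ordered triples \<open>(r, s, t)\<close>. A pair \<open>(r, s)\<close> then occurs
  with \<open>card R - 2\<close> choices of \<open>t\<close>, which is the coefficient of
  \<open>pair_total\<close>.\<close>

lemma sum_z_tilde_mult_pair_total:
  assumes R: "R \<subseteq> {1..N}" and card: "2 \<le> card R"
  shows "scale (of_nat N) (\<Sum>t\<in>R. z_tilde scale N z t * pair_total N z (R - {t})) =
    scale (of_nat N * (of_nat (card R) - 2)) (pair_total N z R) +
    scale 2 (triple_total N z R) + scale (1/2) (quad_total N z R)"
proof -
  have fin: "finite R" using R finite_subset by blast
  define f where "f r s t = scale (of_nat N) (z_tilde scale N z t * pair_sum N z (R - {t}) r s)" for r s t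
  have "scale (of_nat N) (\<Sum>t\<in>R. z_tilde scale N z t * pair_total N z (R - {t})) =
    (\<Sum>t\<in>R. \<Sum>r\<in>R - {t}. \<Sum>s\<in>R - {t} - {r}. f r s t)"
    by (simp add: f_def pair_total_def sum_distrib_left scale_sum_right)
  also have "\<dots> = (\<Sum>r\<in>R. \<Sum>t\<in>R - {r}. \<Sum>s\<in>R - {t} - {r}. f r s t)"
    using fin by (rule sum_swap_remove)
  also have "\<dots> = (\<Sum>r\<in>R. \<Sum>s\<in>R - {r}. \<Sum>t\<in>R - {r, s}. f r s t)"
  proof (rule sum.cong[OF refl])
    fix r
    have "(\<Sum>t\<in>R - {r}. \<Sum>s\<in>R - {t} - {r}. f r s t) = (\<Sum>t\<in>R - {r}. \<Sum>s\<in>R - {r} - {t}. f r s t)"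
      by (rule sum.cong[OF refl]) (metis Diff_insert Diff_insert2)
    also have "\<dots> = (\<Sum>s\<in>R - {r}. \<Sum>t\<in>R - {r} - {s}. f r s t)"
      using fin by (intro sum_swap_remove) simp
    finally show "(\<Sum>t\<in>R - {r}. \<Sum>s\<in>R - {t} - {r}. f r s t) = (\<Sum>s\<in>R - {r}. \<Sum>t\<in>R - {r, s}. f r s t)"
      by (simp only: Diff_insert2[symmetric])
  qed
  also have "\<dots> = (\<Sum>r\<in>R. \<Sum>s\<in>R - {r}. \<Sum>t\<in>R - {r, s}. scale (of_nat N) (pair_sum N z R r s) +
      scale 2 (triple_sum N z R r s t) + scale (1/2) (\<Sum>q\<in>R - {r, s, t}. quad_sum N z R r s q t))"
    unfolding f_def by (intro sum.cong refl z_tilde_mult_pair_sum[OF R]) auto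
  also have "\<dots> = (\<Sum>r\<in>R. \<Sum>s\<in>R - {r}. \<Sum>t\<in>R - {r, s}. scale (of_nat N) (pair_sum N z R r s)) +
      scale 2 (\<Sum>r\<in>R. \<Sum>s\<in>R - {r}. \<Sum>t\<in>R - {r, s}. triple_sum N z R r s t) +
      scale (1/2) (\<Sum>r\<in>R. \<Sum>s\<in>R - {r}. \<Sum>t\<in>R - {r, s}. \<Sum>q\<in>R - {r, s, t}. quad_sum N z R r s q t)"
    by (simp add: sum.distrib scale_sum_right)
  also have "(\<Sum>r\<in>R. \<Sum>s\<in>R - {r}. \<Sum>t\<in>R - {r, s}. scale (of_nat N) (pair_sum N z R r s)) =
      scale (of_nat N * (of_nat (card R) - 2)) (pair_total N z R)"
  proof -
    have "(\<Sum>t\<in>R - {r, s}. scale (of_nat N) (pair_sum N z R r s)) =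
        scale (of_nat N * (of_nat (card R) - 2)) (pair_sum N z R r s)"
      if "r \<in> R" "s \<in> R - {r}" for r s
    proof -
      have "card (R - {r, s}) = card R - 2" using that fin by (simp add: card_Diff_subset)
      then show ?thesis using card by (simp add: sum_constant_scale of_nat_diff mult.commute)
    qed
    then show ?thesis by (simp add: pair_total_def scale_sum_right)
  qed
  also have "(\<Sum>r\<in>R. \<Sum>s\<in>R - {r}. \<Sum>t\<in>R - {r, s}. triple_sum N z R r s t) = triple_total N z R"
    using fin by (simp add: triple_total_def sum_distinct_triples)
  also have "(\<Sum>r\<in>R. \<Sum>s\<in>R - {r}. \<Sum>t\<in>R - {r, s}. \<Sum>q\<in>R - {r, s, t}. quad_sum N z R r s q t) = quad_total N z R"
  proof -
    \<comment> \<open>The quadruple sums carry \<open>q\<close> before \<open>t\<close>, whereas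
      \<open>t\<close> is the outer summation index; exchanging the two matches the order of
      \<open>distinct_quadruples\<close>.\<close>
    have "(\<Sum>t\<in>R - {r, s}. \<Sum>q\<in>R - {r, s, t}. quad_sum N z R r s q t) =
        (\<Sum>q\<in>R - {r, s}. \<Sum>t\<in>R - {r, s, q}. quad_sum N z R r s q t)" for r s
    proof -
      have "R - {r, s, x} = R - {r, s} - {x}" for x by blast
      then show ?thesis using sum_swap_remove[of "R - {r, s}" "\<lambda>t q. quad_sum N z R r s q t"] fin by simp
    qed
    then show ?thesis using fin by (simp add: quad_total_def sum_distinct_quadruples)
  qed
  finally show ?thesis .
qed

section \<open>Averaging over all index sets of a given size\<close>

lemma level_sum_scale: "level_sum scale N n z k (\<lambda>R. scale c (F R)) = scale c (level_sum scale N n z k F)"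
  by (simp add: level_sum_def scale_sum_right flip: scale_mult_right)

lemma level_sum_add:
  "level_sum scale N n z k (\<lambda>R. F R + G R) = level_sum scale N n z k F + level_sum scale N n z k G"
  by (simp add: level_sum_def distrib_left sum.distrib)

lemma level_sum_cong:
  assumes "\<And>R. R \<subseteq> {1..n} \<Longrightarrow> card R = k \<Longrightarrow> F R = G R"
  shows "level_sum scale N n z k F = level_sum scale N n z k G"
  using assms by (simp add: level_sum_def)

text \<open>Double counting: a pair \<open>(R, t)\<close> with \<open>t\<close> in \<open>R\<close>
  corresponds to \<open>(Q, t)\<close> with \<open>Q = R - {t}\<close> and \<open>t\<close> outside
  \<open>Q\<close>. The factor \<open>z_tilde t\<close> completes the weight of the complement of
  \<open>R\<close> to that of \<open>Q\<close>, and each \<open>Q\<close> of size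
  \<open>k - 1\<close> admits \<open>n - (k - 1)\<close> choices of \<open>t\<close>.\<close>

lemma level_sum_step:
  assumes k: "1 \<le> k" "k \<le> n"
  shows "level_sum scale N n z k (\<lambda>R. \<Sum>t\<in>R. z_tilde scale N z t * F (R - {t})) =
    scale (of_nat n - of_nat k + 1) (level_sum scale N n z (k - 1) F)"
proof -
  have fin: "finite R" if "R \<subseteq> {1..n}" for R
    using that by (rule finite_subset) simp
  define G where "G Q = p_tilde scale N z ({1..n} - Q) * F Q" for Q
  have "level_sum scale N n z k (\<lambda>R. \<Sum>t\<in>R. z_tilde scale N z t * F (R - {t})) =
      (\<Sum>R | R \<subseteq> {1..n} \<and> card R = k. \<Sum>t\<in>R. G (R - {t}))"
    unfolding level_sum_def sum_distrib_left
  proof (intro sum.cong refl)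
    fix R t assume R: "R \<in> {R. R \<subseteq> {1..n} \<and> card R = k}" and t: "t \<in> R"
    then have "{1..n} - (R - {t}) = insert t ({1..n} - R)" by auto
    then show "p_tilde scale N z ({1..n} - R) * (z_tilde scale N z t * F (R - {t})) = G (R - {t})"
      using t by (simp add: G_def p_tilde_def mult_ac)
  qed
  also have "\<dots> = (\<Sum>(R, t)\<in>Sigma {R. R \<subseteq> {1..n} \<and> card R = k} (\<lambda>R. R). G (R - {t}))"
    by (rule sum.Sigma) (auto intro: finite_subset[OF _ finite_atLeastAtMost])
  also have "\<dots> = (\<Sum>(Q, t)\<in>Sigma {Q. Q \<subseteq> {1..n} \<and> card Q = k - 1} (\<lambda>Q. {1..n} - Q). G Q)"
    by (rule sum.reindex_bij_witness[of _ "\<lambda>(Q, t). (insert t Q, t)" "\<lambda>(R, t). (R - {t}, t)"])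
       (use k fin in \<open>auto simp: insert_absorb simp del: One_nat_def\<close>)
  also have "\<dots> = (\<Sum>Q | Q \<subseteq> {1..n} \<and> card Q = k - 1. \<Sum>t\<in>{1..n} - Q. G Q)"
    by (rule sum.Sigma[symmetric]) auto
  also have "\<dots> = scale (of_nat n - of_nat k + 1) (level_sum scale N n z (k - 1) F)"
  proof -
    have "(\<Sum>t\<in>{1..n} - Q. G Q) = scale (of_nat n - of_nat k + 1) (G Q)"
      if "Q \<subseteq> {1..n}" "card Q = k - 1" for Q
    proof -
      have "card ({1..n} - Q) = n + 1 - k" using that k by (subst card_Diff_subset) (auto dest: finite_subset)
      then show ?thesis using k by (simp add: sum_constant_scale of_nat_diff)
    qed
    then show ?thesis by (simp add: level_sum_def G_def scale_sum_right)
  qed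
  finally show ?thesis .
qed

section \<open>The starting levels of the recursions\<close>

text \<open>All positions are interchangeable, so \<open>N\<close> copies of the sum for position
  \<open>r\<close> equal the sum over all positions, which is the full sum of \<open>g\<close> for
  every \<open>\<sigma>\<close>.\<close>

lemma perm_sum_entry:
  assumes "r \<in> {1..N}"
  shows "scale (of_nat N) (perm_sum N (\<lambda>\<sigma>. g (\<sigma> r))) = scale (fact N) (\<Sum>j\<in>{1..N}. g j)"
proof -
  have "scale (of_nat N) (perm_sum N (\<lambda>\<sigma>. g (\<sigma> r))) = (\<Sum>m\<in>{1..N}. perm_sum N (\<lambda>\<sigma>. g (\<sigma> r)))"
    by (simp add: sum_constant_scale)
  also have "\<dots> = (\<Sum>m\<in>{1..N}. perm_sum N (\<lambda>\<sigma>. g (\<sigma> m)))"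
  proof (rule sum.cong[OF refl])
    fix m assume "m \<in> {1..N}"
    then show "perm_sum N (\<lambda>\<sigma>. g (\<sigma> r)) = perm_sum N (\<lambda>\<sigma>. g (\<sigma> m))"
      using perm_sum_transpose[OF assms, of m "\<lambda>\<sigma>. g (\<sigma> m)"] by simp
  qed
  also have "\<dots> = perm_sum N (\<lambda>\<sigma>. \<Sum>m\<in>{1..N}. g (\<sigma> m))"
    by (simp add: perm_sum_sum)
  also have "\<dots> = perm_sum N (\<lambda>\<sigma>. \<Sum>m\<in>{1..N}. g m)"
    by (rule perm_sum_cong) (rule sum_perm)
  also have "\<dots> = scale (fact N) (\<Sum>j\<in>{1..N}. g j)"
    by (simp add: perm_sum_const)
  finally show ?thesis .
qed

lemma sum_centred: "(\<Sum>j\<in>{1..N}. z j s - z_tilde scale N z s) = 0"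
  by (cases "N = 0") (simp_all add: sum_subtractf sum_constant_scale scale_z_tilde)

text \<open>Differences do not change when the columns are centred, so the pair sum becomes
  \<open>2 X - 2 Y\<close>, with \<open>X\<close> taken at one position and \<open>Y\<close> at two.
  Centring forces \<open>X + (N - 1) Y = 0\<close>, and multiplying by \<open>N - 1\<close>
  eliminates \<open>Y\<close>, leaving \<open>2 N X\<close>.\<close>

lemma pair_sum_two:
  assumes r: "r \<in> {1..N}" and s: "s \<in> {1..N}" and "r \<noteq> s"
  shows "scale (of_nat N - 1) (pair_sum N z {r, s} r s) =
    scale (2 * fact N) (\<Sum>j\<in>{1..N}. (z j r - z_tilde scale N z r) * (z j s - z_tilde scale N z s))"
proof -
  define x where "x j l = z j l - z_tilde scale N z l" for j l
  define X where "X = perm_sum N (\<lambda>\<sigma>. x (\<sigma> r) r * x (\<sigma> r) s)"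
  define Y where "Y = perm_sum N (\<lambda>\<sigma>. x (\<sigma> r) r * x (\<sigma> s) s)"
  have X': "perm_sum N (\<lambda>\<sigma>. x (\<sigma> s) r * x (\<sigma> s) s) = X"
    using perm_sum_transpose[OF r s, of "\<lambda>\<sigma>. x (\<sigma> r) r * x (\<sigma> r) s"] by (simp add: X_def)
  have Y': "perm_sum N (\<lambda>\<sigma>. x (\<sigma> s) r * x (\<sigma> r) s) = Y"
    using perm_sum_transpose[OF r s, of "\<lambda>\<sigma>. x (\<sigma> r) r * x (\<sigma> s) s"] by (simp add: Y_def)
  have "pair_sum N z {r, s} r s =
      perm_sum N (\<lambda>\<sigma>. x (\<sigma> r) r * x (\<sigma> r) s + x (\<sigma> s) r * x (\<sigma> s) s
        - x (\<sigma> r) r * x (\<sigma> s) s - x (\<sigma> s) r * x (\<sigma> r) s)"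
    unfolding pair_sum_def by (rule perm_sum_cong) (simp add: x_def y_diff_def p_prod_def algebra_simps)
  also have "\<dots> = X + X - Y - Y"
    by (simp add: perm_sum_diff perm_sum_add X' Y' flip: X_def Y_def)
  finally have pair: "pair_sum N z {r, s} r s = scale 2 X - scale 2 Y"
    by (simp add: scale_two)
  \<comment> \<open>A centred column sums to zero; splitting off the position \<open>r\<close>
    relates \<open>X\<close> and \<open>Y\<close>.\<close>
  have "0 = perm_sum N (\<lambda>\<sigma>. x (\<sigma> r) r * (\<Sum>m\<in>{1..N}. x (\<sigma> m) s))"
  proof -
    have "(\<Sum>m\<in>{1..N}. x (\<sigma> m) s) = 0" if "\<sigma> permutes {1..N}" for \<sigma>
      using sum_perm[OF that, of "\<lambda>j. x j s"] sum_centred[of z s N] by (simp add: x_def)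
    then show ?thesis
      by (subst perm_sum_cong[where g = "\<lambda>_. 0"]) (simp_all add: perm_sum_const)
  qed
  also have "\<dots> = (\<Sum>m\<in>{1..N}. perm_sum N (\<lambda>\<sigma>. x (\<sigma> r) r * x (\<sigma> m) s))"
    by (simp add: sum_distrib_left perm_sum_sum)
  also have "\<dots> = X + (\<Sum>m\<in>{1..N} - {r}. perm_sum N (\<lambda>\<sigma>. x (\<sigma> r) r * x (\<sigma> m) s))"
    using sum.remove[OF _ r, of "\<lambda>m. perm_sum N (\<lambda>\<sigma>. x (\<sigma> r) r * x (\<sigma> m) s)"] by (simp add: X_def)
  also have "(\<Sum>m\<in>{1..N} - {r}. perm_sum N (\<lambda>\<sigma>. x (\<sigma> r) r * x (\<sigma> m) s)) = (\<Sum>m\<in>{1..N} - {r}. Y)"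
  proof (rule sum.cong[OF refl])
    fix m assume "m \<in> {1..N} - {r}"
    then show "perm_sum N (\<lambda>\<sigma>. x (\<sigma> r) r * x (\<sigma> m) s) = Y"
      using perm_sum_transpose[OF s, of m "\<lambda>\<sigma>. x (\<sigma> r) r * x (\<sigma> m) s"] \<open>r \<noteq> s\<close>
      by (simp add: Y_def transpose_def)
  qed
  also have "\<dots> = scale (of_nat N - 1) Y"
    using r by (simp add: sum_constant_scale of_nat_diff)
  finally have "scale (of_nat N - 1) Y = - X"
    by (metis add.commute eq_neg_iff_add_eq_0)
  then have "scale (2 * (of_nat N - 1)) Y = - scale 2 X"
    by (simp only: scale_scale[symmetric] scale_minus_right)
  then have "scale (of_nat N - 1) (pair_sum N z {r, s} r s) = scale (2 * (of_nat N - 1)) X + scale 2 X"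
    by (simp add: pair scale_right_diff_distrib mult.commute)
  also have "\<dots> = scale 2 (scale (of_nat N) X)"
    by (simp flip: scale_left_distrib)
  also have "\<dots> = scale (2 * fact N) (\<Sum>j\<in>{1..N}. x j r * x j s)"
    using perm_sum_entry[OF r, of "\<lambda>j. x j r * x j s"] by (simp add: X_def)
  finally show ?thesis by (simp add: x_def)
qed

text \<open>A two-element \<open>R\<close> contains two ordered pairs with equal pair sums, which
  turns the factor 2 of the single pair sum into 4.\<close>

lemma level_sum_pair_total_2:
  assumes "n \<le> N"
  shows "scale (of_nat N - 1) (level_sum scale N n z 2 (pair_total N z)) =
    scale (4 * fact N) (p_tilde2 scale N n z)"
proof -
  have eq: "scale (of_nat N - 1) (pair_total N z R) =
      scale (4 * fact N) (\<Sum>j\<in>{1..N}. \<Prod>r\<in>R. (z j r - z_tilde scale N z r))"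
    if R: "R \<subseteq> {1..n}" "card R = 2" for R
  proof -
    obtain r s where rs: "R = {r, s}" "r \<noteq> s" using R(2) by (auto simp: card_2_iff)
    define c where "c = (\<Sum>j\<in>{1..N}. (z j r - z_tilde scale N z r) * (z j s - z_tilde scale N z s))"
    have "scale (of_nat N - 1) (pair_sum N z R r s) = scale (2 * fact N) c"
      using pair_sum_two[of r N s z] R rs assms by (simp add: c_def)
    moreover have "scale (of_nat N - 1) (pair_sum N z R s r) = scale (2 * fact N) c"
      using pair_sum_two[of s N r z] R rs assms by (simp add: c_def insert_commute mult.commute)
    moreover have "pair_total N z R = pair_sum N z R r s + pair_sum N z R s r"
    proof -
      have "R - {r} = {s}" "R - {s} = {r}" using rs by auto
      then show ?thesis using rs by (simp add: pair_total_def)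
    qed
    ultimately have "scale (of_nat N - 1) (pair_total N z R) = scale (4 * fact N) c"
      by (simp add: scale_right_distrib scale_left_distrib[symmetric])
    then show ?thesis using rs by (simp add: c_def)
  qed
  have "p_tilde2 scale N n z =
      level_sum scale N n z 2 (\<lambda>R. \<Sum>j\<in>{1..N}. \<Prod>r\<in>R. (z j r - z_tilde scale N z r))"
    by (simp only: p_tilde2_def level_sum_def)
  then show ?thesis
    by (simp only: level_sum_scale[symmetric] level_sum_cong[OF eq])
qed

text \<open>A one-element set contains no pair. Thus the recursion for \<open>F\<close> has no
  correction between levels 0 and 1.\<close>

lemma level_sum_pair_total_1: "level_sum scale N n z 1 (pair_total N z) = 0"
proof -
  have "pair_total N z R = 0" if "card R = 1" for R
    using that by (auto simp: pair_total_def card_1_singleton_iff)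
  then show ?thesis by (simp add: level_sum_def)
qed

section \<open>The two recursions in the level\<close>

lemma level_sum_p_prod_step:
  assumes k: "1 \<le> k" "k \<le> n" and "n \<le> N"
  shows "scale (of_nat n - of_nat k + 1) (level_sum scale N n z (k - 1) (\<lambda>R. perm_sum N (\<lambda>\<sigma>. p_prod z \<sigma> R))) =
    scale (of_nat k) (level_sum scale N n z k (\<lambda>R. perm_sum N (\<lambda>\<sigma>. p_prod z \<sigma> R))) +
    scale (1 / (2 * of_nat N)) (level_sum scale N n z k (pair_total N z))"
proof -
  have "N \<noteq> 0" using assms by simp
  have eq: "(\<Sum>s\<in>R. z_tilde scale N z s * perm_sum N (\<lambda>\<sigma>. p_prod z \<sigma> (R - {s}))) =
      scale (of_nat k) (perm_sum N (\<lambda>\<sigma>. p_prod z \<sigma> R)) + scale (1 / (2 * of_nat N)) (pair_total N z R)"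
    if R: "R \<subseteq> {1..n}" "card R = k" for R
  proof -
    have "R \<subseteq> {1..N}" using R(1) \<open>n \<le> N\<close> by force
    from arg_cong[OF sum_z_tilde_mult_p_prod[OF this, of z], of "scale (1 / of_nat N)"]
    show ?thesis using \<open>N \<noteq> 0\<close> by (simp add: scale_right_distrib R(2))
  qed
  show ?thesis
    by (subst level_sum_step[OF k, symmetric])
       (simp only: eq level_sum_add[symmetric] level_sum_scale[symmetric] cong: level_sum_cong)
qed

lemma level_sum_pair_total_step:
  assumes k: "2 \<le> k" "k \<le> n" and "n \<le> N"
  shows "scale (of_nat n - of_nat k + 1) (level_sum scale N n z (k - 1) (pair_total N z)) =
    scale (of_nat k - 2) (level_sum scale N n z k (pair_total N z)) +
    (scale (2 / of_nat N) (level_sum scale N n z k (triple_total N z)) +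
     scale (1 / (2 * of_nat N)) (level_sum scale N n z k (quad_total N z)))"
proof -
  have "N \<noteq> 0" using assms by simp
  have eq: "(\<Sum>t\<in>R. z_tilde scale N z t * pair_total N z (R - {t})) =
      scale (of_nat k - 2) (pair_total N z R) +
      (scale (2 / of_nat N) (triple_total N z R) + scale (1 / (2 * of_nat N)) (quad_total N z R))"
    if R: "R \<subseteq> {1..n}" "card R = k" for R
  proof -
    have "R \<subseteq> {1..N}" "2 \<le> card R" using R k \<open>n \<le> N\<close> by auto
    from arg_cong[OF sum_z_tilde_mult_pair_total[OF this, of z], of "scale (1 / of_nat N)"]
    show ?thesis using \<open>N \<noteq> 0\<close> by (simp add: scale_right_distrib R(2) add.assoc)
  qed
  have "1 \<le> k" using k by simp
  then show ?thesis
    by (subst level_sum_step[OF _ k(2), symmetric])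
       (simp_all only: eq level_sum_add[symmetric] level_sum_scale[symmetric] cong: level_sum_cong)
qed

end

section \<open>Coefficients and telescoping\<close>

lemma choose_pred_mult:
  assumes "1 \<le> k" "k \<le> n"
  shows "of_nat k * of_nat (n choose k) = (of_nat n - of_nat k + 1 :: rat) * of_nat (n choose (k - 1))"
proof -
  have "k * (n choose k) = (n - (k - 1)) * (n choose (k - 1))"
    using binomial_absorb_comp[of n "k - 1"] binomial_absorption[of "k - 1" n] assms by simp
  then have "of_nat (k * (n choose k)) = (of_nat ((n - (k - 1)) * (n choose (k - 1))) :: rat)" by simp
  then show ?thesis using assms by (simp add: of_nat_diff)
qed

text \<open>
  The numbers \<open>\<gamma>\<^sub>k\<close> for which \<open>4 N F\<^sub>k / (n choose k) - \<gamma>\<^sub>k G\<^sub>k\<close> increases by \<open>h\<^sub>k U\<^sub>k\<close> in the step from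
  \<open>k - 1\<close> to \<open>k\<close>; they vanish at \<open>k = n\<close>.
\<close>

definition potential_coeff :: "nat \<Rightarrow> nat \<Rightarrow> rat" where
  "potential_coeff k n = (of_nat n + of_nat k - 1) * (of_nat n - of_nat k) /
     (of_nat k * (of_nat k - 1) * of_nat (n choose k))"

text \<open>This is the coefficient of \<open>G (k - 1)\<close> once
  \<open>h\<^sub>k U\<^sub>k\<close> is rewritten by the recursion for \<open>G\<close>. The bound 3
  keeps the factor \<open>k - 2\<close> in the denominators nonzero.\<close>

lemma potential_coeff_pred:
  assumes "3 \<le> k" "k \<le> n"
  shows "potential_coeff (k - 1) n = h_coeff k n * (of_nat n - of_nat k + 1)"
proof -
  have "of_nat (n choose k) \<noteq> (0::rat)" using assms by simp
  moreover have "of_nat k * of_nat (n choose k) = (of_nat n - of_nat k + 1 :: rat) * of_nat (n choose (k - 1))"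
    using assms by (intro choose_pred_mult) auto
  moreover have "of_nat (n choose (k - 1)) \<noteq> (0::rat)" "of_nat k \<ge> (3::rat)" using assms by auto
  ultimately show ?thesis using assms
    by (simp add: potential_coeff_def h_coeff_def of_nat_diff frac_eq_eq)
qed

text \<open>The companion for the coefficient of \<open>G k\<close>. The subtracted term is the one
  that the recursion for \<open>F\<close> contributes, after the scaling by
  \<open>4 N\<close>.\<close>

lemma potential_coeff_eq:
  assumes "3 \<le> k" "k \<le> n"
  shows "potential_coeff k n = h_coeff k n * (of_nat k - 2) - 2 / (of_nat k * of_nat (n choose k))"
proof -
  have "of_nat (n choose k) \<noteq> (0::rat)" "of_nat k \<ge> (3::rat)" using assms by auto
  then show ?thesis by (simp add: potential_coeff_def h_coeff_def divide_simps) algebra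
qed

text \<open>Induction on \<open>m\<close>, using only the two recursions and \<open>G 1 = 0\<close>,
  hence stated for arbitrary sequences.\<close>

lemma (in rat_algebra) sum_h_coeff_telescope:
  assumes "2 \<le> n" "0 < N" "G 1 = 0" "2 \<le> m" "m \<le> n"
    and F: "\<And>k. 1 \<le> k \<Longrightarrow> k \<le> n \<Longrightarrow>
      scale (of_nat n - of_nat k + 1) (F (k - 1)) = scale (of_nat k) (F k) + scale (1 / (2 * of_nat N)) (G k)"
    and G: "\<And>k. 2 \<le> k \<Longrightarrow> k \<le> n \<Longrightarrow>
      scale (of_nat n - of_nat k + 1) (G (k - 1)) = scale (of_nat k - 2) (G k) + U k"
  shows "(\<Sum>k\<in>{3..m}. scale (h_coeff k n) (U k)) =
    scale (4 * of_nat N) (scale (1 / of_nat (n choose m)) (F m) - F 0) + G 2 - scale (potential_coeff m n) (G m)"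
proof -
  \<comment> \<open>The recursion for \<open>F\<close> divided by \<open>k * (n choose k)\<close>;
    the factor \<open>n - k + 1\<close> is absorbed by passing from \<open>n choose k\<close> to
    \<open>n choose (k - 1)\<close>.\<close>
  have F': "scale (1 / of_nat (n choose k)) (F k) =
      scale (1 / of_nat (n choose (k - 1))) (F (k - 1)) - scale (1 / (2 * of_nat N * (of_nat k * of_nat (n choose k)))) (G k)"
    if k: "1 \<le> k" "k \<le> n" for k
  proof -
    have "of_nat (n choose k) \<noteq> (0::rat)" "of_nat (n choose (k - 1)) \<noteq> (0::rat)" using k by auto
    moreover have eq: "1 / (of_nat k * of_nat (n choose k)) * (of_nat n - of_nat k + 1) = (1 / of_nat (n choose (k - 1)) :: rat)"
      unfolding choose_pred_mult[OF k] using k by (simp add: add_eq_0_iff2)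
    ultimately show ?thesis
      using arg_cong[OF F[OF k], of "scale (1 / (of_nat k * of_nat (n choose k)))"] k
      by (simp add: scale_right_distrib eq mult.commute mult.left_commute)
  qed
  from \<open>2 \<le> m\<close> \<open>m \<le> n\<close> show ?thesis
  proof (induction m rule: dec_induct)
    case base
    have "scale (4 * of_nat N) (scale (1 / of_nat (n choose 2)) (F 2)) =
        scale (4 * of_nat N) (F 0) - scale (4 * of_nat N * (1 / (2 * of_nat N * (2 * of_nat (n choose 2))))) (G 2)"
      using F'[of 1] F'[of 2] \<open>2 \<le> n\<close> \<open>G 1 = 0\<close> by (simp add: scale_right_diff_distrib numeral_2_eq_2)
    \<comment> \<open>The second summand is \<open>1 / (n choose 2)\<close>. The identity makes the
      right-hand side vanish at \<open>m = 2\<close>, where the sum on the left is empty.\<close>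
    moreover have "potential_coeff 2 n + 4 * of_nat N * (1 / (2 * of_nat N * (2 * of_nat (n choose 2)))) = 1"
    proof -
      have c: "2 * of_nat (n choose 2) = (of_nat n * (of_nat n - 1) :: rat)"
        using choose_pred_mult[of 2 n] \<open>2 \<le> n\<close> by (simp add: mult.commute)
      have "of_nat n \<ge> (2::rat)" using \<open>2 \<le> n\<close> by simp
      then have "of_nat n * (of_nat n - 1) \<noteq> (0::rat)" by simp
      then show ?thesis using \<open>0 < N\<close>
        by (simp add: potential_coeff_def c divide_simps) (simp add: algebra_simps)
    qed
    then have "scale (potential_coeff 2 n) (G 2) =
        G 2 - scale (4 * of_nat N * (1 / (2 * of_nat N * (2 * of_nat (n choose 2))))) (G 2)"
      by (metis scale_left_distrib scale_one add_diff_cancel_right')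
    ultimately show ?case
      by (simp add: scale_right_diff_distrib)
  next
    case (step m)
    define k where "k = Suc m"
    have k: "3 \<le> k" "k \<le> n" and m: "m = k - 1" using step by (auto simp: k_def)
    have "{3..k} = insert k {3..m}" "k \<notin> {3..m}" using k by (auto simp: m)
    then have "(\<Sum>i\<in>{3..k}. scale (h_coeff i n) (U i)) =
        scale (h_coeff k n) (U k) + (\<Sum>i\<in>{3..m}. scale (h_coeff i n) (U i))"
      by simp
    also have "U k = scale (of_nat n - of_nat k + 1) (G m) - scale (of_nat k - 2) (G k)"
      using G[of k] k by (simp add: m)
    also have "scale (h_coeff k n) \<dots> = scale (potential_coeff m n) (G m) -
        scale (potential_coeff k n + 2 / (of_nat k * of_nat (n choose k))) (G k)"
      unfolding m potential_coeff_pred[OF k] potential_coeff_eq[OF k] by (simp add: scale_right_diff_distrib)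
    also have "(\<Sum>i\<in>{3..m}. scale (h_coeff i n) (U i)) =
        scale (4 * of_nat N) (scale (1 / of_nat (n choose m)) (F m) - F 0) + G 2 - scale (potential_coeff m n) (G m)"
      using step by simp
    also have "scale (1 / of_nat (n choose m)) (F m) =
        scale (1 / of_nat (n choose k)) (F k) + scale (1 / (2 * of_nat N * (of_nat k * of_nat (n choose k)))) (G k)"
      using F'[of k] k by (simp add: m)
    finally show ?case
      using \<open>0 < N\<close> unfolding k_def[symmetric]
      by (simp add: scale_right_diff_distrib scale_right_distrib scale_left_distrib)
  qed
qed


section \<open>From permutations back to injective tuples\<close>

text \<open>One extension \<open>p\<close> is built by matching the positions after \<open>n\<close>
  with the values missed by \<open>j\<close>. All extensions are then
  \<open>p \<circ> \<tau>\<close> with \<open>\<tau>\<close> a permutation of these last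
  \<open>N - n\<close> positions.\<close>

lemma card_permutes_extending:
  assumes j: "j \<in> inj_tuples N n" and "n \<le> N"
  shows "card {\<sigma>. \<sigma> permutes {1..N} \<and> restrict \<sigma> {1..n} = j} = fact (N - n)"
proof -
  let ?A = "{1..n}" and ?B = "{n+1..N}"
  have un: "{1..N} = ?A \<union> ?B" using \<open>n \<le> N\<close> by auto
  have inj: "inj_on j ?A" and jN: "j ` ?A \<subseteq> {1..N}" and ext: "j \<in> extensional ?A"
    using j by (auto simp: inj_tuples_def PiE_def)
  have "card ({1..N} - j ` ?A) = card ?B"
    using card_image[OF inj] card_Diff_subset[OF _ jN] by simp
  then obtain h where h: "bij_betw h ?B ({1..N} - j ` ?A)"
    using finite_same_card_bij[of ?B "{1..N} - j ` ?A"] by (metis finite_Diff finite_atLeastAtMost)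
  define p where "p i = (if i \<in> ?A then j i else if i \<in> ?B then h i else i)" for i
  have "bij_betw p ?A (j ` ?A)"
    using inj_on_imp_bij_betw[OF inj] by (rule bij_betw_cong[THEN iffD1, rotated]) (simp add: p_def)
  moreover have "bij_betw p ?B ({1..N} - j ` ?A)"
    using h by (rule bij_betw_cong[THEN iffD1, rotated]) (auto simp: p_def)
  ultimately have "bij_betw p (?A \<union> ?B) (j ` ?A \<union> ({1..N} - j ` ?A))"
    by (rule bij_betw_combine) auto
  moreover have "j ` ?A \<union> ({1..N} - j ` ?A) = {1..N}" using jN by blast
  ultimately have p: "p permutes {1..N}"
    using un by (intro bij_imp_permutes) (auto simp: p_def)
  have pj: "p i = j i" if "i \<in> ?A" for i using that by (simp add: p_def)
  have "bij_betw (\<lambda>\<tau>. p \<circ> \<tau>) {\<tau>. \<tau> permutes ?B} {\<sigma>. \<sigma> permutes {1..N} \<and> restrict \<sigma> ?A = j}"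
  proof (rule bij_betw_byWitness[where f' = "\<lambda>\<sigma>. inv p \<circ> \<sigma>"])
    show "(\<lambda>\<tau>. p \<circ> \<tau>) ` {\<tau>. \<tau> permutes ?B} \<subseteq> {\<sigma>. \<sigma> permutes {1..N} \<and> restrict \<sigma> ?A = j}"
    proof clarify
      fix \<tau> assume \<tau>: "\<tau> permutes ?B"
      have "\<tau> permutes {1..N}" using \<tau> un by (auto intro: permutes_subset)
      moreover have "restrict (p \<circ> \<tau>) ?A = j"
      proof (rule extensionalityI[of _ ?A])
        fix i assume i: "i \<in> ?A"
        then have "\<tau> i = i" using permutes_not_in[OF \<tau>, of i] by simp
        then show "restrict (p \<circ> \<tau>) ?A i = j i" using i by (simp add: pj)
      qed (use ext in auto)
      ultimately show "p \<circ> \<tau> permutes {1..N} \<and> restrict (p \<circ> \<tau>) ?A = j"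
        using p by (auto intro: permutes_compose)
    qed
    show "(\<lambda>\<sigma>. inv p \<circ> \<sigma>) ` {\<sigma>. \<sigma> permutes {1..N} \<and> restrict \<sigma> ?A = j} \<subseteq> {\<tau>. \<tau> permutes ?B}"
    proof clarify
      fix \<sigma> assume \<sigma>: "\<sigma> permutes {1..N}" and j: "j = restrict \<sigma> ?A"
      have "inv p \<circ> \<sigma> permutes {1..N}" using \<sigma> p by (auto intro: permutes_compose permutes_inv)
      then show "inv p \<circ> \<sigma> permutes ?B"
      proof (rule permutes_superset)
        fix i assume "i \<in> {1..N} - ?B"
        then have i: "i \<in> ?A" using un by blast
        then have "\<sigma> i = p i" by (simp add: pj j)
        then show "(inv p \<circ> \<sigma>) i = i" using permutes_inverses(2)[OF p] by simp
      qed
    qed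
  qed (use permutes_inverses[OF p] in \<open>auto simp: fun_eq_iff\<close>)
  then have "card {\<sigma>. \<sigma> permutes {1..N} \<and> restrict \<sigma> ?A = j} = card {\<tau>. \<tau> permutes ?B}"
    by (rule bij_betw_same_card[symmetric])
  also have "\<dots> = fact (N - n)" by (rule card_permutations) simp_all
  finally show ?thesis .
qed

context rat_algebra
begin

text \<open>Permutations are grouped by their restriction to \<open>{1..n}\<close>. The assumption
  on \<open>f\<close> makes it constant on each group, and all groups have the same size.\<close>

lemma perm_sum_eq_sum_inj_tuples:
  assumes "n \<le> N" and f: "\<And>\<sigma>. f (restrict \<sigma> {1..n}) = f \<sigma>"
  shows "perm_sum N f = scale (fact (N - n)) (\<Sum>j\<in>inj_tuples N n. f j)"
proof -
  have "perm_sum N f = (\<Sum>j\<in>inj_tuples N n. \<Sum>\<sigma> | \<sigma> \<in> {\<sigma>. \<sigma> permutes {1..N}} \<and> restrict \<sigma> {1..n} = j. f \<sigma>)"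
    unfolding perm_sum_def
  proof (rule sum.group[symmetric])
    show "finite (inj_tuples N n)"
      by (rule finite_subset[of _ "{1..n} \<rightarrow>\<^sub>E {1..N}"]) (auto simp: inj_tuples_def intro: finite_PiE)
    show "(\<lambda>\<sigma>. restrict \<sigma> {1..n}) ` {\<sigma>. \<sigma> permutes {1..N}} \<subseteq> inj_tuples N n"
    proof clarify
      fix \<sigma> assume \<sigma>: "\<sigma> permutes {1..N}"
      then have "\<sigma> i \<in> {1..N}" if "i \<in> {1..n}" for i
        using permutes_in_image[OF \<sigma>, of i] that \<open>n \<le> N\<close> by auto
      moreover have "inj_on \<sigma> {1..n}" using permutes_inj[OF \<sigma>] by (rule inj_on_subset) simp
      ultimately show "restrict \<sigma> {1..n} \<in> inj_tuples N n" by (auto simp: inj_tuples_def)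
    qed
  qed (simp add: finite_permutations)
  also have "\<dots> = (\<Sum>j\<in>inj_tuples N n. scale (fact (N - n)) (f j))"
  proof (rule sum.cong[OF refl])
    fix j assume j: "j \<in> inj_tuples N n"
    have "(\<Sum>\<sigma> | \<sigma> \<in> {\<sigma>. \<sigma> permutes {1..N}} \<and> restrict \<sigma> {1..n} = j. f \<sigma>) =
        (\<Sum>\<sigma> | \<sigma> permutes {1..N} \<and> restrict \<sigma> {1..n} = j. f j)"
      by (rule sum.cong) (auto simp: f[simplified])
    also have "\<dots> = scale (fact (N - n)) (f j)"
      by (simp only: sum_constant_scale card_permutes_extending[OF j \<open>n \<le> N\<close>] of_nat_fact)
    finally show "(\<Sum>\<sigma> | \<sigma> \<in> {\<sigma>. \<sigma> permutes {1..N}} \<and> restrict \<sigma> {1..n} = j. f \<sigma>) = scale (fact (N - n)) (f j)" .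
  qed
  finally show ?thesis by (simp add: scale_sum_right)
qed

lemma p_prod_restrict: "R \<subseteq> A \<Longrightarrow> p_prod z (restrict \<sigma> A) R = p_prod z \<sigma> R"
  by (auto simp: p_prod_def intro!: prod.cong)

lemma perm_sum_p_prod:
  assumes "n \<le> N"
  shows "perm_sum N (\<lambda>\<sigma>. p_prod z \<sigma> {1..n}) = scale (fact (N - n)) (p_bar N n z {1..n})"
  unfolding p_bar_def by (rule perm_sum_eq_sum_inj_tuples[OF assms]) (simp add: p_prod_restrict)

lemma level_sum_triple_total:
  assumes "n \<le> N"
  shows "level_sum scale N n z k (triple_total N z) = scale (fact (N - n))
    (\<Sum>R | R \<subseteq> {1..n} \<and> card R = k. \<Sum>(r, s, t)\<in>distinct_triples R.
      p_tilde scale N z ({1..n} - R) *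
      (\<Sum>j\<in>inj_tuples N n.
        y_diff z (j r) (j s) r * y_diff z (j r) (j s) s * y_diff z (j r) (j t) t *
        p_prod z j (R - {r, s, t})))"
proof -
  have "triple_sum N z R r s t = scale (fact (N - n)) (\<Sum>j\<in>inj_tuples N n.
        y_diff z (j r) (j s) r * y_diff z (j r) (j s) s * y_diff z (j r) (j t) t *
        p_prod z j (R - {r, s, t}))"
    if "R \<subseteq> {1..n}" "(r, s, t) \<in> distinct_triples R" for R r s t
  proof -
    have "{r, s, t} \<subseteq> {1..n}" "R - {r, s, t} \<subseteq> {1..n}" using that by (auto simp: distinct_triples_def)
    then show ?thesis unfolding triple_sum_def
      by (intro perm_sum_eq_sum_inj_tuples[OF assms]) (simp add: p_prod_restrict)
  qed
  then show ?thesis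
    unfolding level_sum_def triple_total_def scale_sum_right sum_distrib_left
    by (intro sum.cong refl) (auto simp: scale_mult_right scale_sum_right sum_distrib_left)
qed

lemma level_sum_quad_total:
  assumes "n \<le> N"
  shows "level_sum scale N n z k (quad_total N z) = scale (fact (N - n))
    (\<Sum>R | R \<subseteq> {1..n} \<and> card R = k. \<Sum>(q, r, s, t)\<in>distinct_quadruples R.
      p_tilde scale N z ({1..n} - R) *
      (\<Sum>j\<in>inj_tuples N n.
        y_diff z (j q) (j r) q * y_diff z (j q) (j r) r *
        y_diff z (j s) (j t) s * y_diff z (j s) (j t) t *
        p_prod z j (R - {q, r, s, t})))"
proof -
  have "quad_sum N z R q r s t = scale (fact (N - n)) (\<Sum>j\<in>inj_tuples N n.
        y_diff z (j q) (j r) q * y_diff z (j q) (j r) r *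
        y_diff z (j s) (j t) s * y_diff z (j s) (j t) t *
        p_prod z j (R - {q, r, s, t}))"
    if "R \<subseteq> {1..n}" "(q, r, s, t) \<in> distinct_quadruples R" for R q r s t
  proof -
    have "{q, r, s, t} \<subseteq> {1..n}" "R - {q, r, s, t} \<subseteq> {1..n}" using that by (auto simp: distinct_quadruples_def)
    then show ?thesis unfolding quad_sum_def
      by (intro perm_sum_eq_sum_inj_tuples[OF assms]) (simp add: p_prod_restrict)
  qed
  then show ?thesis
    unfolding level_sum_def quad_total_def scale_sum_right sum_distrib_left
    by (intro sum.cong refl) (auto simp: scale_mult_right scale_sum_right sum_distrib_left)
qed

text \<open>Three elements admit no four distinct indices. This reconciles the telescoped sum, which
  starts at level 3, with a quadruple sum that starts at level 4.\<close>

lemma level_sum_quad_total_3: "level_sum scale N n z 3 (quad_total N z) = 0"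
proof -
  have "quad_total N z R = 0" if "card R = 3" for R
  proof -
    have "finite R" using that by (simp add: card_ge_0_finite)
    then have "card {q, r, s, t} \<le> 3" if "{q, r, s, t} \<subseteq> R" for q r s t
      using card_mono[OF _ that] \<open>card R = 3\<close> by simp
    then have "distinct_quadruples R = {}"
      by (fastforce simp: distinct_quadruples_def)
    then show ?thesis by (simp add: quad_total_def)
  qed
  then show ?thesis by (simp add: level_sum_def)
qed

end

section \<open>Assembly of the identity\<close>

theorem theorem3p10:
  fixes scale :: "rat \<Rightarrow> 'a::{comm_ring, comm_monoid_mult} \<Rightarrow> 'a"
    and N n :: nat
    and z :: "nat \<Rightarrow> nat \<Rightarrow> 'a"
  assumes "rat_algebra scale"
    and "2 \<le> n" and "n \<le> N"
  shows
    "p_bar N n z {1..n}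
       - scale (fact N / fact (N - n)) (p_tilde scale N z {1..n})
       + scale (fact (N - 2) / fact (N - n)) (p_tilde2 scale N n z)
     = scale (1 / (2 * (of_nat N)^2))
         (\<Sum>k\<in>{1..n} - {1..2}. scale (h_coeff k n)
           (\<Sum>R | R \<subseteq> {1..n} \<and> card R = k. \<Sum>(r, s, t)\<in>distinct_triples R.
              p_tilde scale N z ({1..n} - R) *
              (\<Sum>j\<in>inj_tuples N n.
                 y_diff z (j r) (j s) r * y_diff z (j r) (j s) s * y_diff z (j r) (j t) t *
                 p_prod z j (R - {r, s, t}))))
     + scale (1 / (8 * (of_nat N)^2))
         (\<Sum>k\<in>{1..n} - {1..3}. scale (h_coeff k n)
           (\<Sum>R | R \<subseteq> {1..n} \<and> card R = k. \<Sum>(q, r, s, t)\<in>distinct_quadruples R.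
              p_tilde scale N z ({1..n} - R) *
              (\<Sum>j\<in>inj_tuples N n.
                 y_diff z (j q) (j r) q * y_diff z (j q) (j r) r *
                 y_diff z (j s) (j t) s * y_diff z (j s) (j t) t *
                 p_prod z j (R - {q, r, s, t}))))"
    (is "?L = scale _ (\<Sum>k\<in>_. scale _ (?T k)) + scale _ (\<Sum>k\<in>_. scale _ (?Q k))")
proof -
  interpret rat_algebra scale by fact
  define F where "F k = level_sum scale N n z k (\<lambda>R. perm_sum N (\<lambda>\<sigma>. p_prod z \<sigma> R))" for k
  define G where "G k = level_sum scale N n z k (pair_total N z)" for k
  define T where "T k = level_sum scale N n z k (triple_total N z)" for k
  define Q where "Q k = level_sum scale N n z k (quad_total N z)" for k
  define c :: rat where "c = fact (N - n)"
  define d :: rat where "d = of_nat N"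
  \<comment> \<open>The bound on \<open>d\<close> makes both \<open>d\<close> and
    \<open>d - 1\<close> invertible.\<close>
  have c: "c \<noteq> 0" and d: "d \<ge> 2" using assms by (simp_all add: c_def d_def)
  have T: "T k = scale c (?T k)" and Q: "Q k = scale c (?Q k)" for k
    unfolding T_def Q_def c_def
    by (rule level_sum_triple_total[OF \<open>n \<le> N\<close>], rule level_sum_quad_total[OF \<open>n \<le> N\<close>])
  have F0: "F 0 = scale (fact N) (p_tilde scale N z {1..n})"
  proof -
    have "{R. R \<subseteq> {1..n} \<and> card R = 0} = {{}}" by (auto dest: finite_subset)
    then show ?thesis
      by (simp add: F_def level_sum_def p_prod_def perm_sum_const scale_mult_right[symmetric])
  qed
  have Fn: "F n = scale c (p_bar N n z {1..n})"
  proof -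
    have "{R. R \<subseteq> {1..n} \<and> card R = n} = {{1..n}}"
      using card_subset_eq[of "{1..n}"] by auto
    then show ?thesis
      by (simp add: F_def level_sum_def p_tilde_def perm_sum_p_prod[OF \<open>n \<le> N\<close>, simplified] c_def)
  qed
  have G2: "G 2 = scale (4 * fact N / (d - 1)) (p_tilde2 scale N n z)"
    using arg_cong[OF level_sum_pair_total_2[OF \<open>n \<le> N\<close>, of z], of "scale (1 / (d - 1))"] d
    by (simp add: G_def d_def)
  \<comment> \<open>Needed to turn the coefficient \<open>4 N! / (N - 1)\<close> of
    \<open>G 2\<close>, divided by \<open>4 c d\<close>, into
    \<open>(N - 2)! / (N - n)!\<close>.\<close>
  have factN: "fact N = (d * (d - 1) * fact (N - 2) :: rat)"
  proof -
    obtain M where "N = Suc (Suc M)" using assms by (metis Suc_le_D le_trans numeral_2_eq_2 Suc_le_mono)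
    then show ?thesis by (simp add: d_def algebra_simps)
  qed
  have "(\<Sum>k\<in>{3..n}. scale (h_coeff k n) (scale (2 / d) (T k) + scale (1 / (2 * d)) (Q k))) =
      scale (4 * d) (scale (1 / of_nat (n choose n)) (F n) - F 0) + G 2 - scale (potential_coeff n n) (G n)"
    unfolding d_def
  proof (rule sum_h_coeff_telescope)
    show "G 1 = 0" by (simp only: G_def level_sum_pair_total_1)
    show "scale (of_nat n - of_nat k + 1) (F (k - 1)) =
        scale (of_nat k) (F k) + scale (1 / (2 * of_nat N)) (G k)" if "1 \<le> k" "k \<le> n" for k
      unfolding F_def G_def using that \<open>n \<le> N\<close> by (rule level_sum_p_prod_step)
    show "scale (of_nat n - of_nat k + 1) (G (k - 1)) = scale (of_nat k - 2) (G k) +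
        (scale (2 / of_nat N) (T k) + scale (1 / (2 * of_nat N)) (Q k))" if "2 \<le> k" "k \<le> n" for k
      unfolding G_def T_def Q_def using that \<open>n \<le> N\<close> by (rule level_sum_pair_total_step)
  qed (use assms in auto)
  \<comment> \<open>At the top level the binomial coefficient is 1 and the potential coefficient is
    0.\<close>
  also have "\<dots> = scale (4 * d) (F n - F 0) + G 2"
    by (simp add: potential_coeff_def)
  finally have main: "scale (4 * d) (F n - F 0) + G 2 =
      scale (2 * c / d) (\<Sum>k\<in>{3..n}. scale (h_coeff k n) (?T k)) +
      scale (c / (2 * d)) (\<Sum>k\<in>{3..n}. scale (h_coeff k n) (?Q k))"
    by (simp add: T Q scale_right_distrib sum.distrib scale_sum_right mult_ac)
  \<comment> \<open>The divisor \<open>4 c d\<close> normalizes the coefficient of the permanent to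
    1.\<close>
  have "?L = scale (1 / (4 * c * d)) (scale (4 * d) (F n - F 0) + G 2)"
    using c d by (simp add: Fn F0 G2 factN scale_right_distrib scale_right_diff_distrib c_def[symmetric])
  also have "\<dots> = scale (1 / (2 * d^2)) (\<Sum>k\<in>{3..n}. scale (h_coeff k n) (?T k)) +
      scale (1 / (8 * d^2)) (\<Sum>k\<in>{3..n}. scale (h_coeff k n) (?Q k))"
    unfolding main using c d by (simp add: scale_right_distrib power2_eq_square)
  also have "(\<Sum>k\<in>{3..n}. scale (h_coeff k n) (?Q k)) = (\<Sum>k\<in>{1..n} - {1..3}. scale (h_coeff k n) (?Q k))"
  proof (rule sum.mono_neutral_right)
    have Q3: "?Q 3 = 0" using Q[of 3] c by (simp add: Q_def level_sum_quad_total_3)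
    show "\<forall>k\<in>{3..n} - ({1..n} - {1..3}). scale (h_coeff k n) (?Q k) = 0"
    proof
      fix k assume "k \<in> {3..n} - ({1..n} - {1..3})"
      then have k: "k = 3" by auto
      show "scale (h_coeff k n) (?Q k) = 0" unfolding k Q3 by (rule scale_zero_right)
    qed
  qed auto
  \<comment> \<open>For \<open>n = 2\<close> this set is empty, which realizes the convention that
    the right-hand side is then zero.\<close>
  also have "{3..n} = {1..n} - {1..2}" by auto
  finally show ?thesis by (simp only: d_def)
qed

end
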